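(* The following statement admits a counterexample: "for $n\geqslant 3$ and every closed definable germ $(X,0)\subsetneq(\mathbb{R}^n,0)$ with $\mathrm{Aff}(C_0X)=\mathbb{R}^k\times\{0\}^{n-k}$ for some $1\leqslant k<n$, which is not superquadratic, one has $0\notin\overline{M_X}$." In other words, there exist $n\geqslant 3$ and a closed definable non-superquadratic germ $(X,0)\subsetneq(\mathbb{R}^n,0)$ with $\mathrm{Aff}(C_0X)=\mathbb{R}^k\times\{0\}^{n-k}$ for some $1\leqslant k<n$, such that $0\in\overline{M_X}$.
   Context: "Definable" means definable in a polynomially bounded o-minimal structure on the field $\mathbb{R}$. A germ is represented by a closed definable set $X\subset\mathbb{R}^n$ with $0\in X$. $m(p)=\{x\in X\mid \|p-x\|=d(p,X)\}$ (Euclidean distance), and the medial axis is $M_X=\{p\in\mathbb{R}^n\mid \# m(p)>1\}$. The Peano tangent cone is $C_0X=\{w\mid \exists\,X\ni x_\nu\to 0,\ \exists\,\lambda_\nu>0:\ \lambda_\nu x_\nu\to w\}$; $\mathrm{Aff}$ denotes the affine hull. Writing points of $\mathbb{R}^n$ as $(x,y)\in\mathbb{R}^k\times\mathbb{R}^{n-k}$, the general curvature is $\theta(X,0)=\sup\{\theta>0\mid (X,0)\subset\{\|y\|\leqslant c\|x\|^\theta\}\text{ for some constant } c>0\}$, where inclusion of germs means that the intersection of $X$ with some neighbourhood of $0$ is contained in the right-hand set. The germ $(X,0)$ is called superquadratic if $\theta(X,0)<2$, and non-superquadratic otherwise. *)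

theory Defs
  imports
    "HOL-Analysis.Analysis"
    "HOL-Library.Function_Algebras"
    "HOL-Library.Landau_Symbols"
begin

text \<open>
  The dimension is bound by a quantifier, so $\mathbb{R}^n$ is the carrier of
  \<^const>\<open>Euclidean_space\<close> \<open>n\<close>: the functions from \<^typ>\<open>nat\<close> to \<^typ>\<open>real\<close> that vanish at
  all indices \<open>i \<ge> n\<close>, with coordinates indexed from 0. In particular $\mathbb{R}^k$ is a subset
  of $\mathbb{R}^n$ for \<open>k \<le> n\<close>, namely $\mathbb{R}^k \times \{0\}^{n-k}$.
\<close>

abbreviation Rn :: "nat \<Rightarrow> (nat \<Rightarrow> real) set" where
  "Rn n \<equiv> topspace (Euclidean_space n)"

text \<open>The pointwise vector space structure, which makes \<^const>\<open>hull\<close> with \<^const>\<open>affine\<close> available.\<close>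

instantiation "fun" :: (type, real_vector) real_vector
begin

definition scaleR_fun :: "real \<Rightarrow> ('a \<Rightarrow> 'b) \<Rightarrow> 'a \<Rightarrow> 'b" where
  "scaleR_fun r f = (\<lambda>x. r *\<^sub>R f x)"

instance
  by standard (auto simp: scaleR_fun_def fun_eq_iff algebra_simps)

end

lemma scaleR_fun_apply [simp]: "(r *\<^sub>R f) x = r *\<^sub>R f x"
  by (simp add: scaleR_fun_def)

section \<open>Polynomially bounded o-minimal structures on the real field\<close>

text \<open>\<open>S n\<close> is the collection of definable subsets of $\mathbb{R}^n$.\<close>

locale o_minimal_structure =
  fixes S :: "nat \<Rightarrow> (nat \<Rightarrow> real) set set"
  assumes boolean: "algebra (Rn n) (S n)"
    and prod_right: "A \<in> S n \<Longrightarrow> {x \<in> Rn (Suc n). x(n := 0) \<in> A} \<in> S (Suc n)"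
    and prod_left: "A \<in> S n \<Longrightarrow> {x \<in> Rn (Suc n). (\<lambda>i. x (Suc i)) \<in> A} \<in> S (Suc n)"
    and diagonal: "i < n \<Longrightarrow> j < n \<Longrightarrow> {x \<in> Rn n. x i = x j} \<in> S n"
    and projection: "A \<in> S (Suc n) \<Longrightarrow> (\<lambda>x. x(n := 0)) ` A \<in> S n"
    and less: "{x \<in> Rn 2. x 0 < x 1} \<in> S 2"
    and add: "{x \<in> Rn 3. x 2 = x 0 + x 1} \<in> S 3"
    and mult: "{x \<in> Rn 3. x 2 = x 0 * x 1} \<in> S 3"
    \<comment> \<open>\<^const>\<open>is_interval\<close> admits all intervals, bounded or not, including points: the definable
      subsets of the line are exactly the finite unions of points and open intervals.\<close>
    and o_minimal: "(\<lambda>t i. if i = 0 then t else 0) ` B \<in> S 1 \<longleftrightarrow>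
      (\<exists>F. finite F \<and> (\<forall>I\<in>F. is_interval I) \<and> B = \<Union>F)"

locale polynomially_bounded_o_minimal_structure = o_minimal_structure +
  assumes polynomially_bounded:
    "{x \<in> Rn 2. x 1 = f (x 0)} \<in> S 2 \<Longrightarrow> \<exists>N::nat. f \<in> O[at_top](\<lambda>t. t ^ N)"

section \<open>Medial axis\<close>

definition edist :: "nat \<Rightarrow> (nat \<Rightarrow> real) \<Rightarrow> (nat \<Rightarrow> real) \<Rightarrow> real" where
  "edist n p q = L2_set (p - q) {..<n}"

definition dist_to_set :: "nat \<Rightarrow> (nat \<Rightarrow> real) \<Rightarrow> (nat \<Rightarrow> real) set \<Rightarrow> real" where
  "dist_to_set n p X = (INF x\<in>X. edist n p x)"

definition closest_points :: "nat \<Rightarrow> (nat \<Rightarrow> real) set \<Rightarrow> (nat \<Rightarrow> real) \<Rightarrow> (nat \<Rightarrow> real) set" where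
  "closest_points n X p = {x \<in> X. edist n p x = dist_to_set n p X}"

text \<open>More than one closest point is not \<open>card > 1\<close>, since \<^const>\<open>card\<close> is 0 on infinite sets.\<close>

definition medial_axis :: "nat \<Rightarrow> (nat \<Rightarrow> real) set \<Rightarrow> (nat \<Rightarrow> real) set" where
  "medial_axis n X = {p \<in> Rn n. \<exists>a\<in>closest_points n X p. \<exists>b\<in>closest_points n X p. a \<noteq> b}"

section \<open>Tangent cone and general curvature at the origin\<close>

definition tangent_cone :: "nat \<Rightarrow> (nat \<Rightarrow> real) set \<Rightarrow> (nat \<Rightarrow> real) set" where
  "tangent_cone n X = {w. \<exists>(a :: nat \<Rightarrow> nat \<Rightarrow> real) (l :: nat \<Rightarrow> real).
     (\<forall>\<nu>. a \<nu> \<in> X) \<and> limitin (Euclidean_space n) a 0 sequentially \<and>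
     (\<forall>\<nu>. l \<nu> > 0) \<and> limitin (Euclidean_space n) (\<lambda>\<nu>. l \<nu> *\<^sub>R a \<nu>) w sequentially}"

definition germ_subset :: "nat \<Rightarrow> (nat \<Rightarrow> real) set \<Rightarrow> (nat \<Rightarrow> real) set \<Rightarrow> bool" where
  "germ_subset n X Y \<longleftrightarrow> (\<exists>U. openin (Euclidean_space n) U \<and> 0 \<in> U \<and> X \<inter> U \<subseteq> Y)"

text \<open>The horn $\{\|y\| \le c\|x\|^\theta\}$ for $(x,y) \in \mathbb{R}^k \times \mathbb{R}^{n-k}$.\<close>

definition horn :: "nat \<Rightarrow> nat \<Rightarrow> real \<Rightarrow> real \<Rightarrow> (nat \<Rightarrow> real) set" where
  "horn n k c \<theta> = {p \<in> Rn n. L2_set p {k..<n} \<le> c * L2_set p {..<k} powr \<theta>}"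

text \<open>Extended reals, as the curvature is infinite e.g. for germs contained in
  $\mathbb{R}^k \times \{0\}^{n-k}$.\<close>

definition general_curvature :: "nat \<Rightarrow> nat \<Rightarrow> (nat \<Rightarrow> real) set \<Rightarrow> ereal" where
  "general_curvature n k X =
     Sup {ereal \<theta> | \<theta>. \<theta> > 0 \<and> (\<exists>c>0. germ_subset n X (horn n k c \<theta>))}"

definition superquadratic :: "nat \<Rightarrow> nat \<Rightarrow> (nat \<Rightarrow> real) set \<Rightarrow> bool" where
  "superquadratic n k X \<longleftrightarrow> general_curvature n k X < 2"

end

theory Submission
  imports Defs
begin

text \<open>
  The counterexample is flat: the union of the first two coordinate axes of $\mathbb{R}^3$.
  It lies in $\mathbb{R}^2 \times \{0\}$, so its curvature is infinite, and it is a cone, so it is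
  its own tangent cone and spans $\mathbb{R}^2 \times \{0\}$. Each point $(t,t,0)$ with $t > 0$ is at
  distance $t$ from exactly the two points $(t,0,0)$ and $(0,t,0)$ of the cross, and these
  points tend to the origin.
\<close>

definition cross :: "(nat \<Rightarrow> real) set" where
  "cross = {x \<in> Rn 3. x 0 * x 1 = 0 \<and> x 2 = 0}"

definition axis_point :: "nat \<Rightarrow> real \<Rightarrow> nat \<Rightarrow> real" where
  "axis_point j t = (\<lambda>i. if i = j then t else 0)"

definition diag_point :: "real \<Rightarrow> nat \<Rightarrow> real" where
  "diag_point t = (\<lambda>i. if i < 2 then t else 0)"

text \<open>\<open>Euclidean_space n\<close> is a subspace of the product topology, so limits can be
  checked coordinate by coordinate.\<close>

lemma limitin_Euclidean_space_iff:
  "limitin (Euclidean_space n) f l F \<longleftrightarrow>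
     l \<in> Rn n \<and> (\<forall>\<^sub>F a in F. f a \<in> Rn n) \<and> (\<forall>i. ((\<lambda>a. f a i) \<longlongrightarrow> l i) F)"
  by (auto simp: Euclidean_space_def limitin_subtopology limitin_componentwise)

text \<open>The constant 0 enters through the axiom \<open>o_minimal\<close>, since a point is a
  degenerate interval. Each use of \<open>prod_left\<close> then puts one free coordinate in front,
  so after two uses the condition sits on index 2.\<close>

lemma (in o_minimal_structure) coordinate_plane_definable: "{x \<in> Rn 3. x 2 = 0} \<in> S 3"
proof -
  have "(\<lambda>t i::nat. if i = 0 then t else 0) ` {0::real} \<in> S 1"
    by (subst o_minimal, rule exI[of _ "{{0}}"]) (auto simp: is_interval_1)
  then have "{0} \<in> S 1"
    by (simp add: zero_fun_def)
  then have "{x \<in> Rn (Suc 1). (\<lambda>i. x (Suc i)) \<in> {0}} \<in> S (Suc 1)"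
    by (rule prod_left)
  then have "{x \<in> Rn (Suc (Suc 1)). (\<lambda>i. x (Suc i)) \<in> {x \<in> Rn (Suc 1). (\<lambda>i. x (Suc i)) \<in> {0}}}
      \<in> S (Suc (Suc 1))"
    by (rule prod_left)
  also have "{x \<in> Rn (Suc (Suc 1)). (\<lambda>i. x (Suc i)) \<in> {x \<in> Rn (Suc 1). (\<lambda>i. x (Suc i)) \<in> {0}}}
      = {x \<in> Rn 3. x 2 = 0}"
  proof -
    have "(\<forall>i. x (Suc (Suc i)) = 0) \<longleftrightarrow> x 2 = 0" if "\<forall>i\<ge>3. x i = 0" for x :: "nat \<Rightarrow> real"
    proof
      assume "x 2 = 0"
      moreover have "Suc (Suc i) = 2 \<or> Suc (Suc i) \<ge> 3" for i
        by linarith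
      ultimately show "\<forall>i. x (Suc (Suc i)) = 0"
        using that by metis
    qed (metis numeral_2_eq_2)
    then show ?thesis
      by (auto simp: topspace_Euclidean_space fun_eq_iff numeral_3_eq_3)
  qed
  finally show ?thesis
    by (simp add: numeral_3_eq_3)
qed

lemma (in o_minimal_structure) cross_definable: "cross \<in> S 3"
proof -
  interpret algebra "Rn 3" "S 3"
    by (rule boolean)
  \<comment> \<open>Cutting the graph of multiplication at height 0 leaves exactly the pairs with
    product 0.\<close>
  have "cross = {x \<in> Rn 3. x 2 = x 0 * x 1} \<inter> {x \<in> Rn 3. x 2 = 0}"
    by (auto simp: cross_def)
  with Int[OF mult coordinate_plane_definable] show ?thesis
    by (simp only:)
qed

text \<open>The equations define a closed set of the full product space, in which
  \<open>Rn 3\<close> is closed as well.\<close>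

lemma closedin_cross: "closedin (Euclidean_space 3) cross"
proof -
  have "continuous_on UNIV (\<lambda>x::nat \<Rightarrow> real. x i)" for i
    by simp
  then have "closed {x :: nat \<Rightarrow> real. x 0 * x 1 = 0 \<and> x 2 = 0}"
    by (intro closed_Collect_conj closed_Collect_eq continuous_on_mult) auto
  moreover have "closed (Rn 3)"
    using closedin_Euclidean_space_iff closedin_topspace by blast
  ultimately have "closed ({x. x 0 * x 1 = 0 \<and> x 2 = 0} \<inter> Rn 3)"
    by (rule closed_Int)
  also have "{x. x 0 * x 1 = 0 \<and> x 2 = 0} \<inter> Rn 3 = cross"
    by (auto simp: cross_def)
  finally show ?thesis
    by (auto simp: closedin_Euclidean_space_iff cross_def)
qed

lemma axis_point_in_cross: "j < 2 \<Longrightarrow> axis_point j t \<in> cross"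
  by (auto simp: cross_def axis_point_def topspace_Euclidean_space)

text \<open>As \<open>t\<close> decreases to 0, \<open>diag_point t\<close> tends to the origin in
  every coordinate. This yields both the closure of the medial axis and the properness of the
  germ.\<close>

lemma diag_point_in_open:
  assumes "openin (Euclidean_space 3) U" "0 \<in> U"
  obtains t where "t > 0" "diag_point t \<in> U"
proof -
  have "((\<lambda>t. diag_point t i) \<longlongrightarrow> 0) (at_right 0)" for i
    by (cases "i < 2") (simp_all add: diag_point_def)
  then have "limitin (Euclidean_space 3) diag_point 0 (at_right 0)"
    by (simp add: limitin_Euclidean_space_iff topspace_Euclidean_space)
      (simp add: diag_point_def)
  then have "\<forall>\<^sub>F t in at_right 0. diag_point t \<in> U"
    using assms by (auto simp: limitin_def)
  then have "\<forall>\<^sub>F t in at_right 0. diag_point t \<in> U \<and> t > 0"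
    using eventually_at_right_less by (rule eventually_conj)
  from eventually_happens'[OF _ this] show ?thesis
    using that by auto
qed

text \<open>One of \<open>x 0\<close> and \<open>x 1\<close> vanishes on \<open>cross\<close>, so
  one of the two squares in the distance already equals \<open>t\<close> squared.\<close>

lemma edist_diag_point_le:
  assumes "x \<in> cross" "t > 0"
  shows "t \<le> edist 3 (diag_point t) x"
proof -
  have "t\<^sup>2 \<le> (t - x 0)\<^sup>2 + (t - x 1)\<^sup>2"
    using assms by (auto simp: cross_def)
  then have "t \<le> sqrt ((t - x 0)\<^sup>2 + (t - x 1)\<^sup>2)"
    by (rule real_le_rsqrt)
  with assms show ?thesis
    by (simp add: edist_def L2_set_def cross_def diag_point_def eval_nat_numeral)
qed

lemma edist_diag_point_axis_point:
  assumes "j < 2" "t > 0"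
  shows "edist 3 (diag_point t) (axis_point j t) = t"
  using assms
  by (auto simp: edist_def L2_set_def diag_point_def axis_point_def eval_nat_numeral less_Suc_eq)

lemma diag_point_in_medial_axis:
  assumes "t > 0"
  shows "diag_point t \<in> medial_axis 3 cross"
proof -
  have "dist_to_set 3 (diag_point t) cross = t"
    unfolding dist_to_set_def
  proof (rule cInf_eq_minimum)
    \<comment> \<open>The lower bound \<open>t\<close> is attained at \<open>axis_point 0 t\<close>,
      so the infimum is a minimum.\<close>
    show "t \<in> edist 3 (diag_point t) ` cross"
      using edist_diag_point_axis_point[OF _ assms, of 0] axis_point_in_cross[of 0 t] by force
  qed (use edist_diag_point_le assms in auto)
  then have "axis_point j t \<in> closest_points 3 cross (diag_point t)" if "j < 2" for j
    using that assms by (simp add: closest_points_def axis_point_in_cross edist_diag_point_axis_point)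
  from this[of 0] this[of 1] have "axis_point 0 t \<in> closest_points 3 cross (diag_point t)"
    "axis_point 1 t \<in> closest_points 3 cross (diag_point t)"
    by simp_all
  moreover have "axis_point 0 t \<noteq> axis_point 1 t"
    using assms by (auto simp: axis_point_def fun_eq_iff)
  moreover have "diag_point t \<in> Rn 3"
    by (simp add: diag_point_def topspace_Euclidean_space)
  ultimately show ?thesis
    unfolding medial_axis_def by blast
qed

text \<open>The axes are invariant under scaling: shrinking by \<open>Suc \<nu>\<close> gives a
  sequence in \<open>cross\<close> tending to 0, and multiplying back gives a constant sequence. The
  successor keeps the factor positive; \<open>s\<close> may have any sign.\<close>

lemma axis_point_in_tangent_cone:
  assumes "j < 2"
  shows "axis_point j s \<in> tangent_cone 3 cross"
proof -
  have "(\<lambda>\<nu>. s / real (Suc \<nu>)) \<longlonglongrightarrow> 0"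
    by (rule LIMSEQ_Suc[OF lim_const_over_n])
  then have "(\<lambda>\<nu>. axis_point j (s / real (Suc \<nu>)) i) \<longlonglongrightarrow> 0" for i
    by (cases "i = j") (simp_all add: axis_point_def)
  then have "limitin (Euclidean_space 3) (\<lambda>\<nu>. axis_point j (s / real (Suc \<nu>))) 0 sequentially"
    using assms
    by (simp del: of_nat_Suc add: limitin_Euclidean_space_iff topspace_Euclidean_space)
      (simp add: axis_point_def)
  moreover have "real (Suc \<nu>) *\<^sub>R axis_point j (s / real (Suc \<nu>)) = axis_point j s" for \<nu>
    by (auto simp: axis_point_def fun_eq_iff simp del: of_nat_Suc)
  then have "limitin (Euclidean_space 3)
      (\<lambda>\<nu>. real (Suc \<nu>) *\<^sub>R axis_point j (s / real (Suc \<nu>))) (axis_point j s) sequentially"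
    using assms
    by (auto simp del: of_nat_Suc
        simp: limitin_Euclidean_space_iff topspace_Euclidean_space axis_point_def)
  ultimately show ?thesis
    unfolding tangent_cone_def using assms axis_point_in_cross
    by (intro CollectI exI[of _ "\<lambda>\<nu>. axis_point j (s / real (Suc \<nu>))"]
        exI[of _ "\<lambda>\<nu>. real (Suc \<nu>)"]) auto
qed

text \<open>The coordinate of index 2 is 0 along every rescaled sequence from \<open>cross\<close>,
  hence also in the limit.\<close>

lemma tangent_cone_cross_subset: "tangent_cone 3 cross \<subseteq> Rn 2"
proof
  fix w assume "w \<in> tangent_cone 3 cross"
  then obtain a :: "nat \<Rightarrow> nat \<Rightarrow> real" and l where a: "\<And>\<nu>. a \<nu> \<in> cross"
    and lim: "limitin (Euclidean_space 3) (\<lambda>\<nu>. l \<nu> *\<^sub>R a \<nu>) w sequentially"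
    by (auto simp: tangent_cone_def)
  have "(\<lambda>\<nu>. (l \<nu> *\<^sub>R a \<nu>) 2) \<longlonglongrightarrow> w 2" and w: "\<forall>i\<ge>3. w i = 0"
    using lim unfolding limitin_Euclidean_space_iff topspace_Euclidean_space by blast+
  moreover have "a \<nu> 2 = 0" for \<nu>
    using a by (simp add: cross_def)
  ultimately have "w 2 = 0"
    by (simp add: LIMSEQ_const_iff)
  with w show "w \<in> Rn 2"
    by (auto simp: topspace_Euclidean_space) (metis Suc_leI eval_nat_numeral(3) le_neq_implies_less)
qed

lemma affine_Rn: "affine (Rn n)"
  by (simp add: affine_def topspace_Euclidean_space)

lemma affine_hull_tangent_cone_cross: "affine hull (tangent_cone 3 cross) = Rn 2"
proof
  show "affine hull (tangent_cone 3 cross) \<subseteq> Rn 2"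
    by (intro hull_minimal tangent_cone_cross_subset affine_Rn)
  show "Rn 2 \<subseteq> affine hull (tangent_cone 3 cross)"
  proof
    fix w assume w: "w \<in> Rn 2"
    have "axis_point j s \<in> affine hull (tangent_cone 3 cross)" if "j < 2" for j s
      using that by (intro hull_inc axis_point_in_tangent_cone)
    \<comment> \<open>An affine combination needs weights with sum 1, so \<open>w\<close> is written
      as the midpoint of two axis points with doubled coordinates.\<close>
    then have "(1/2) *\<^sub>R axis_point 0 (2 * w 0) + (1/2) *\<^sub>R axis_point 1 (2 * w 1)
        \<in> affine hull (tangent_cone 3 cross)"
      by (intro mem_affine affine_affine_hull) auto
    also have "(1/2) *\<^sub>R axis_point 0 (2 * w 0) + (1/2) *\<^sub>R axis_point 1 (2 * w 1) = w"
    proof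
      fix i :: nat
      consider "i = 0" | "i = 1" | "i \<ge> 2"
        by linarith
      then show "((1/2) *\<^sub>R axis_point 0 (2 * w 0) + (1/2) *\<^sub>R axis_point 1 (2 * w 1)) i = w i"
        using w by cases (auto simp: axis_point_def topspace_Euclidean_space)
    qed
    finally show "w \<in> affine hull (tangent_cone 3 cross)" .
  qed
qed

text \<open>The norm of the \<open>y\<close> part is 0 on \<open>cross\<close>, so the horn
  inequality holds globally with exponent 2 and constant 1. That exponent bounds the supremum from
  below by 2.\<close>

lemma not_superquadratic_cross: "\<not> superquadratic 3 2 cross"
proof -
  have "{2..<3::nat} = {2}"
    by auto
  then have "cross \<subseteq> horn 3 2 1 2"
    by (auto simp: cross_def horn_def)
  then have "germ_subset 3 cross (horn 3 2 1 2)"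
    unfolding germ_subset_def
    by (intro exI[of _ "Rn 3"]) (auto simp: topspace_Euclidean_space[THEN eqset_imp_iff])
  then have "ereal 2 \<le> general_curvature 3 2 cross"
    unfolding general_curvature_def by (intro Sup_upper CollectI exI[of _ 2]) (auto intro: exI[of _ 1])
  then show ?thesis
    by (simp add: superquadratic_def not_less)
qed

text \<open>Every neighbourhood of the origin contains some \<open>diag_point t\<close> with
  \<open>t > 0\<close>, and there the product of the first two coordinates is nonzero.\<close>

lemma not_germ_subset_Rn_cross: "\<not> germ_subset 3 (Rn 3) cross"
proof
  assume "germ_subset 3 (Rn 3) cross"
  then obtain U where U: "openin (Euclidean_space 3) U" "0 \<in> U" "Rn 3 \<inter> U \<subseteq> cross"
    by (auto simp: germ_subset_def)
  obtain t where "t > 0" "diag_point t \<in> U"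
    using diag_point_in_open U by blast
  moreover from this have "diag_point t \<in> cross"
    using U openin_subset by blast
  ultimately show False
    by (simp add: cross_def diag_point_def)
qed

text \<open>The same witness \<open>cross\<close>, with \<open>n = 3\<close> and
  \<open>k = 2\<close>, serves for every structure \<open>S\<close>.\<close>

theorem proposition6p1:
  fixes S :: "nat \<Rightarrow> (nat \<Rightarrow> real) set set"
  assumes "polynomially_bounded_o_minimal_structure S"
  shows "\<exists>n\<ge>3. \<exists>X k.
    closedin (Euclidean_space n) X \<and> X \<in> S n \<and> 0 \<in> X \<and>
    \<not> germ_subset n (Rn n) X \<and>
    1 \<le> k \<and> k < n \<and> affine hull (tangent_cone n X) = Rn k \<and>
    \<not> superquadratic n k X \<and>
    0 \<in> Euclidean_space n closure_of medial_axis n X"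
proof -
  interpret polynomially_bounded_o_minimal_structure S
    by (rule assms)
  have "0 \<in> cross"
    by (simp add: cross_def topspace_Euclidean_space)
  moreover have "0 \<in> Euclidean_space 3 closure_of medial_axis 3 cross"
    unfolding in_closure_of
  proof (intro conjI allI impI)
    show "0 \<in> Rn 3"
      by (simp add: topspace_Euclidean_space)
    fix U assume "0 \<in> U \<and> openin (Euclidean_space 3) U"
    then obtain t where "t > 0" "diag_point t \<in> U"
      using diag_point_in_open by blast
    then show "\<exists>y. y \<in> medial_axis 3 cross \<and> y \<in> U"
      using diag_point_in_medial_axis by blast
  qed
  ultimately have "closedin (Euclidean_space 3) cross \<and> cross \<in> S 3 \<and> 0 \<in> cross \<and>
    \<not> germ_subset 3 (Rn 3) cross \<and>
    1 \<le> (2::nat) \<and> 2 < (3::nat) \<and> affine hull (tangent_cone 3 cross) = Rn 2 \<and>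
    \<not> superquadratic 3 2 cross \<and>
    0 \<in> Euclidean_space 3 closure_of medial_axis 3 cross"
    using closedin_cross cross_definable not_germ_subset_Rn_cross affine_hull_tangent_cone_cross
      not_superquadratic_cross
    by simp
  then show ?thesis
    by (meson order_refl)
qed

end
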